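(* Let $d\in\mathbb{N}$ and let $Q(t)=Q_0(t)+C_{\boldsymbol{q}(t)}$ for $t\geqslant 0$, where $Q_0\colon[0,\infty)\to\mathcal{A}_0$ and $\boldsymbol{q}\colon[0,\infty)\to\mathbb{R}^d$ are continuous, the matrices $Q_0(t)$ commute, that is, $[Q_0(t),Q_0(s)]=0$ for all $t,s\geqslant 0$, and $\operatorname{tr}(C_{\boldsymbol{q}(t)})=q_1(t)+\dots+q_d(t)=0$ for all $t\geqslant 0$. Consider the Cauchy problem $\dot M=MQ$ with $M(0)=\mathbb{1}$. Then, at least for small $t\geqslant 0$, the solution is of the form $M(t)=\exp(R(t))$ with $R(t)=R_0(t)+R_{\triangle}(t)$, where $$R_0(t)=\int_0^t Q_0(\tau)\,d\tau\qquad\text{and}\qquad R_{\triangle}(t)=\int_0^t C_{\boldsymbol{q}(\tau)}\,\mathrm{e}^{-R_0(\tau)}\,d\tau\cdot f\bigl(-R_0(t)\bigr).$$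
   Context: $\mathcal{A}_0$ is the algebra of real $d\times d$ matrices with all row sums equal to $0$. For a row vector $\boldsymbol{x}\in\mathbb{R}^d$, $C_{\boldsymbol{x}}$ is the real $d\times d$ matrix all of whose rows equal $\boldsymbol{x}$. $\mathbb{1}$ is the identity matrix and $[A,B]=AB-BA$. The function $f$ is $f(z)=\dfrac{z}{\mathrm{e}^z-1}$ with $f(0)=1$; its power series around $0$ has radius of convergence $2\pi$, and $f$ of a matrix with spectral radius less than $2\pi$ is defined via this power series. *)

theory Defs
  imports "HOL-Analysis.Analysis"
begin

definition row_sum_zero :: "(real ^ 'n ^ 'n) set" where
  "row_sum_zero = {A. \<forall>i. (\<Sum>j\<in>UNIV. A $ i $ j) = 0}"

definition const_rows :: "real ^ 'n \<Rightarrow> real ^ 'n ^ 'n" where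
  "const_rows x = (\<chi> i. x)"

definition mat_comm :: "real ^ 'n ^ 'n \<Rightarrow> real ^ 'n ^ 'n \<Rightarrow> real ^ 'n ^ 'n" where
  "mat_comm A B = A ** B - B ** A"

text \<open>
  The type \<open>real ^ 'n ^ 'n\<close> carries the entrywise product, so the library's power and \<open>exp\<close>,
  which are based on \<open>(*)\<close>, cannot be used for the matrix product \<open>(**)\<close>.
\<close>

primrec mat_power :: "real ^ 'n ^ 'n \<Rightarrow> nat \<Rightarrow> real ^ 'n ^ 'n" where
  "mat_power A 0 = mat 1"
| "mat_power A (Suc k) = A ** mat_power A k"

definition mat_series :: "(nat \<Rightarrow> real) \<Rightarrow> real ^ 'n ^ 'n \<Rightarrow> real ^ 'n ^ 'n" where
  "mat_series c A = (\<Sum>k. c k *\<^sub>R mat_power A k)"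

definition mat_exp :: "real ^ 'n ^ 'n \<Rightarrow> real ^ 'n ^ 'n" where
  "mat_exp = mat_series (\<lambda>k. 1 / fact k)"

definition bern_fun :: "real \<Rightarrow> real" where
  "bern_fun z = (if z = 0 then 1 else z / (exp z - 1))"

text \<open>
  The coefficients are those of the Taylor series of \<open>bern_fun\<close> at \<open>0\<close>; since they are real, they
  agree with those of the complex function.  The value is meaningful only if the spectral radius
  of the argument is less than \<open>2 * pi\<close>; otherwise the series need not converge and its sum is
  unspecified.
\<close>

definition mat_bern_fun :: "real ^ 'n ^ 'n \<Rightarrow> real ^ 'n ^ 'n" where
  "mat_bern_fun = mat_series (\<lambda>k. (deriv ^^ k) bern_fun 0 / fact k)"

definition complex_eigenvalues :: "real ^ 'n ^ 'n \<Rightarrow> complex set" where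
  "complex_eigenvalues A =
     {l. \<exists>v :: complex ^ 'n. v \<noteq> 0 \<and> map_matrix complex_of_real A *v v = l *s v}"

definition spectral_radius :: "real ^ 'n ^ 'n \<Rightarrow> real" where
  "spectral_radius A = (SUP l \<in> complex_eigenvalues A. cmod l)"

text \<open>Derivatives at end points of \<open>S\<close> are one-sided.\<close>

definition solves_cauchy ::
    "(real \<Rightarrow> real ^ 'n ^ 'n) \<Rightarrow> (real \<Rightarrow> real ^ 'n ^ 'n) \<Rightarrow> real set \<Rightarrow> bool" where
  "solves_cauchy Q M S \<longleftrightarrow>
     M 0 = mat 1 \<and> (\<forall>t\<in>S. (M has_vector_derivative M t ** Q t) (at t within S))"

end

theory Submission
  imports Defs
begin

text \<open>
  A matrix \<open>A\<close> with vanishing row sums kills every matrix with constant rows from the left,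
  \<open>A C\<^sub>x = 0\<close>.  Since the entries of \<open>q\<close> add up to \<open>0\<close>, the matrices \<open>C\<^sub>q\<close> have vanishing row sums
  themselves, and so does \<open>P(t) = \<integral>\<^sub>0\<^sup>t C\<^sub>q exp(-R\<^sub>0)\<close>, because \<open>exp(-R\<^sub>0)\<close> preserves the row sums.  Hence
  \<open>R\<^sub>0 P = 0\<close> and \<open>P P = 0\<close>, and the same relations hold for \<open>D = P f(-R\<^sub>0)\<close> in place of \<open>P\<close>.

  These relations collapse the exponential series to \<open>exp(R\<^sub>0 + D) = exp R\<^sub>0 + D \<phi>(R\<^sub>0)\<close> with
  \<open>\<phi>(z) = (e\<^sup>z - 1) / z\<close> (\<open>mat_exp_add_left_annihilated\<close>).  The function \<open>f\<close> is \<open>1 / \<phi>\<close>, and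
  \<open>\<phi>(z) = e\<^sup>z \<phi>(-z)\<close>, so \<open>f(-z) \<phi>(z) = e\<^sup>z\<close>.  This gives the closed form
  \<open>exp(R) = (1 + P) exp(R\<^sub>0)\<close> (\<open>mat_exp_add_bern\<close>), from which the differential equation can be read off:
  the values of \<open>Q\<^sub>0\<close> commute, so \<open>exp(R\<^sub>0)\<close> has derivative \<open>exp(R\<^sub>0) Q\<^sub>0\<close>, and therefore \<open>exp(R)\<close> has derivative
  \<open>exp(R) Q\<^sub>0 + C\<^sub>q\<close>, where \<open>C\<^sub>q = exp(R) C\<^sub>q\<close>.

  For uniqueness, let \<open>M\<close> be any solution.  As \<open>Q\<close> has vanishing row sums,
  the row sums of \<open>M\<close> are constant; they equal \<open>1\<close>, which means \<open>M C\<^sub>q = C\<^sub>q\<close>.  Then \<open>M exp(-R\<^sub>0)\<close> has the derivative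
  \<open>C\<^sub>q exp(-R\<^sub>0)\<close>, which does not depend on \<open>M\<close>, so \<open>M exp(-R\<^sub>0) = 1 + P\<close>.

  The series for \<open>f\<close> has a positive radius of convergence, being the inverse of the entire series
  \<open>\<phi>\<close> with \<open>\<phi>(0) = 1\<close>, and the norm of \<open>R\<^sub>0(t)\<close> lies below this radius and below \<open>2\<pi>\<close> for small
  \<open>t\<close>, because \<open>R\<^sub>0\<close> is continuous and \<open>R\<^sub>0(0) = 0\<close>.
\<close>

section \<open>The Frobenius norm\<close>

lemma norm_matrix_vector_mult_le:
  fixes A :: "('a::real_normed_field)^'n^'m"
  shows "norm (A *v v) \<le> norm A * norm v"
proof -
  have row: "norm ((A *v v) $ i) \<le> norm (A $ i) * norm v" for i
  proof -
    have "norm ((A *v v) $ i) \<le> (\<Sum>j\<in>UNIV. norm (A $ i $ j) * norm (v $ j))"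
      unfolding matrix_vector_mult_def by (simp add: sum_norm_le norm_mult)
    also have "\<dots> \<le> norm (A $ i) * norm v"
      using L2_set_mult_ineq[of "\<lambda>j. norm (A $ i $ j)" "\<lambda>j. norm (v $ j)" UNIV]
      by (simp add: norm_vec_def)
    finally show ?thesis .
  qed
  have "norm (A *v v) \<le> L2_set (\<lambda>i. norm (A $ i) * norm v) UNIV"
    unfolding norm_vec_def[of "A *v v"] by (intro L2_set_mono row norm_ge_zero)
  also have "\<dots> = norm A * norm v"
    by (simp add: norm_vec_def[of A] L2_set_left_distrib)
  finally show ?thesis .
qed

text \<open>
  The norm of the type \<open>real^'n^'m\<close> is the Frobenius norm, which is submultiplicative: each row of
  \<open>A B\<close> is a combination of rows of \<open>B\<close>, to which the Cauchy-Schwarz inequality applies.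
\<close>

lemma norm_matrix_mult_le:
  fixes A :: "real^'n^'m" and B :: "real^'p^'n"
  shows "norm (A ** B) \<le> norm A * norm B"
proof -
  have row: "norm ((A ** B) $ i) \<le> norm (A $ i) * norm B" for i
  proof -
    have "(A ** B) $ i = (\<Sum>k\<in>UNIV. A $ i $ k *\<^sub>R B $ k)"
      by (simp add: matrix_matrix_mult_def vec_eq_iff)
    then have "norm ((A ** B) $ i) \<le> (\<Sum>k\<in>UNIV. \<bar>A $ i $ k\<bar> * norm (B $ k))"
      by (simp add: sum_norm_le)
    also have "\<dots> \<le> norm (A $ i) * norm B"
      using L2_set_mult_ineq[of "\<lambda>k. norm (A $ i $ k)" "\<lambda>k. norm (B $ k)" UNIV]
      by (simp add: norm_vec_def[of B] norm_vec_def[of "A $ i"])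
    finally show ?thesis .
  qed
  have "norm (A ** B) \<le> L2_set (\<lambda>i. norm (A $ i) * norm B) UNIV"
    unfolding norm_vec_def[of "A ** B"] by (intro L2_set_mono row norm_ge_zero)
  also have "\<dots> = norm A * norm B"
    by (simp add: norm_vec_def[of A] L2_set_left_distrib)
  finally show ?thesis .
qed

lemma bounded_bilinear_matrix_mult:
  "bounded_bilinear ((**) :: real^'n^'m \<Rightarrow> real^'p^'n \<Rightarrow> real^'p^'m)"
proof
  show "\<exists>K. \<forall>A B. norm ((A :: real^'n^'m) ** (B :: real^'p^'n)) \<le> norm A * norm B * K"
    by (intro exI[of _ 1]) (simp add: norm_matrix_mult_le)
qed (simp_all add: vec_eq_iff matrix_matrix_mult_def sum.distrib algebra_simps sum_distrib_left)

interpretation matrix_mult: bounded_bilinear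
  "(**) :: real^'n^'m \<Rightarrow> real^'p^'n \<Rightarrow> real^'p^'m"
  by (rule bounded_bilinear_matrix_mult)

lemma norm_complex_eigenvalue_le:
  fixes A :: "real^'n^'n"
  assumes "l \<in> complex_eigenvalues A"
  shows "cmod l \<le> norm A"
proof -
  obtain v :: "complex^'n" where v: "v \<noteq> 0" "map_matrix complex_of_real A *v v = l *s v"
    using assms by (auto simp: complex_eigenvalues_def)
  have "norm (l *s v) = cmod l * norm v"
    by (simp add: norm_vec_def norm_mult L2_set_right_distrib)
  then have "cmod l * norm v \<le> norm (map_matrix complex_of_real A) * norm v"
    using norm_matrix_vector_mult_le[of "map_matrix complex_of_real A" v] v(2) by simp
  moreover have "norm (map_matrix complex_of_real A) = norm A"
    by (simp add: norm_vec_def map_matrix_def)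
  ultimately show ?thesis using v(1) by simp
qed

lemma spectral_radius_le_norm:
  assumes "complex_eigenvalues A \<noteq> {}"
  shows "spectral_radius A \<le> norm A"
  unfolding spectral_radius_def
  by (intro cSUP_least assms norm_complex_eigenvalue_le)

section \<open>Power series in a matrix\<close>

text \<open>
  Sequences of coefficients are written as formal power series from here on, so that products,
  derivatives and the substitution of \<open>-z\<close> can be computed formally and radii of convergence are
  at hand.
\<close>

lemma norm_mat_power_le: "norm (mat_power A k) \<le> norm (mat 1 :: real^'n^'n) * norm (A::real^'n^'n) ^ k"
proof (induction k)
  case (Suc k)
  have "norm (mat_power A (Suc k)) \<le> norm A * norm (mat_power A k)"
    by (simp add: norm_matrix_mult_le)
  also have "\<dots> \<le> norm A * (norm (mat 1 :: real^'n^'n) * norm A ^ k)"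
    by (intro mult_left_mono Suc norm_ge_zero)
  finally show ?case by (simp add: mult_ac)
qed simp

lemma mat_power_add: "mat_power A (m + n) = mat_power A m ** mat_power A n"
  by (induction m) (simp_all add: matrix_mul_assoc)

lemma mat_power_commute:
  assumes "A ** B = B ** A"
  shows "mat_power A k ** B = B ** mat_power A k"
proof (induction k)
  case (Suc k)
  have "mat_power A (Suc k) ** B = A ** (B ** mat_power A k)"
    using Suc by (simp flip: matrix_mul_assoc)
  also have "\<dots> = (B ** A) ** mat_power A k"
    unfolding matrix_mul_assoc assms ..
  finally show ?case by (simp add: matrix_mul_assoc)
qed simp

lemma mat_power_uminus: "mat_power (- A) k = (- 1) ^ k *\<^sub>R mat_power A k"
proof (induction k)
  case (Suc k)
  show ?case
    unfolding mat_power.simps Suc matrix_mult.scaleR_right matrix_mult.minus_left by simp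
qed simp

lemma summable_norm_mat_series:
  fixes A :: "real^'n^'n"
  assumes "ereal (norm A) < fps_conv_radius F"
  shows "summable (\<lambda>k. norm (fps_nth F k *\<^sub>R mat_power A k))"
proof -
  have "summable (\<lambda>k. norm (fps_nth F k * norm A ^ k))"
    using assms by (intro abs_summable_in_conv_radius) (simp add: fps_conv_radius_def)
  then have "summable (\<lambda>k. norm (mat 1 :: real^'n^'n) * norm (fps_nth F k * norm A ^ k))"
    by (rule summable_mult)
  then show ?thesis
  proof (rule summable_comparison_test[rotated], intro exI allI impI)
    fix k
    show "norm (norm (fps_nth F k *\<^sub>R mat_power A k))
            \<le> norm (mat 1 :: real^'n^'n) * norm (fps_nth F k * norm A ^ k)"
      using mult_left_mono[OF norm_mat_power_le[of A k], of "\<bar>fps_nth F k\<bar>"]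
      by (simp add: abs_mult mult_ac)
  qed
qed

lemma mat_series_sums:
  fixes A :: "real^'n^'n"
  assumes "ereal (norm A) < fps_conv_radius F"
  shows "(\<lambda>k. fps_nth F k *\<^sub>R mat_power A k) sums mat_series (fps_nth F) A"
  unfolding mat_series_def
  by (rule summable_sums[OF summable_norm_cancel[OF summable_norm_mat_series[OF assms]]])

text \<open>
  Each entry of the product is a finite sum of products of real series, so the Cauchy product of
  absolutely convergent real series yields the claim entry by entry.
\<close>

lemma mat_series_mult:
  fixes A :: "real^'n^'n"
  assumes F: "ereal (norm A) < fps_conv_radius F" and G: "ereal (norm A) < fps_conv_radius G"
  shows "mat_series (fps_nth F) A ** mat_series (fps_nth G) A = mat_series (fps_nth (F * G)) A"
proof -
  define a where "a i j k = fps_nth F k * mat_power A k $ i $ j" for i j k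
  define b where "b i j k = fps_nth G k * mat_power A k $ i $ j" for i j k
  have entry: "bounded_linear (\<lambda>X::real^'n^'n. X $ i $ j)" for i j
    by (intro bounded_linear_compose[OF bounded_linear_vec_nth] bounded_linear_vec_nth)
  have le: "\<bar>X $ i $ j\<bar> \<le> norm X" for X :: "real^'n^'n" and i j
    using component_le_norm_cart[of "X $ i" j] Finite_Cartesian_Product.norm_nth_le[of X i] by simp
  have abs_a: "summable (\<lambda>k. norm (a i j k))" for i j
    by (rule summable_comparison_test[OF _ summable_norm_mat_series[OF F]])
       (use le[of "fps_nth F _ *\<^sub>R mat_power A _"] in \<open>auto simp: a_def\<close>)
  have abs_b: "summable (\<lambda>k. norm (b i j k))" for i j
    by (rule summable_comparison_test[OF _ summable_norm_mat_series[OF G]])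
       (use le[of "fps_nth G _ *\<^sub>R mat_power A _"] in \<open>auto simp: b_def\<close>)
  have a: "(\<Sum>k. a i j k) = mat_series (fps_nth F) A $ i $ j" for i j
    using bounded_linear.sums[OF entry mat_series_sums[OF F], of i j]
    by (simp add: a_def sums_iff)
  have b: "(\<Sum>k. b i j k) = mat_series (fps_nth G) A $ i $ j" for i j
    using bounded_linear.sums[OF entry mat_series_sums[OF G], of i j]
    by (simp add: b_def sums_iff)
  have "(\<lambda>n. (fps_nth (F * G) n *\<^sub>R mat_power A n) $ i $ j) sums
          (mat_series (fps_nth F) A ** mat_series (fps_nth G) A) $ i $ j" for i j
  proof -
    have "(\<lambda>n. \<Sum>l\<in>UNIV. \<Sum>m\<le>n. a i l m * b l j (n - m)) sums
            (\<Sum>l\<in>UNIV. (\<Sum>k. a i l k) * (\<Sum>k. b l j k))"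
      by (intro sums_sum Cauchy_product_sums abs_a abs_b)
    moreover have "(\<Sum>l\<in>UNIV. \<Sum>m\<le>n. a i l m * b l j (n - m))
        = (fps_nth (F * G) n *\<^sub>R mat_power A n) $ i $ j" for n
    proof -
      have "(\<Sum>l\<in>UNIV. \<Sum>m\<le>n. a i l m * b l j (n - m))
          = (\<Sum>m\<le>n. fps_nth F m * fps_nth G (n - m) * (mat_power A m ** mat_power A (n - m)) $ i $ j)"
        unfolding a_def b_def matrix_matrix_mult_def
        by (subst sum.swap) (simp add: sum_distrib_left mult_ac)
      also have "\<dots> = (\<Sum>m\<le>n. fps_nth F m * fps_nth G (n - m) * mat_power A n $ i $ j)"
        by (intro sum.cong refl) (simp flip: mat_power_add)
      finally show ?thesis
        by (simp add: fps_mult_nth sum_distrib_right atLeast0AtMost)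
    qed
    ultimately show ?thesis
      by (simp add: a b matrix_matrix_mult_def)
  qed
  then have eq: "(\<lambda>n. fps_nth (F * G) n *\<^sub>R mat_power A n) sums
       (mat_series (fps_nth F) A ** mat_series (fps_nth G) A)"
    unfolding sums_def by (intro vec_tendstoI) simp
  then show ?thesis
    unfolding mat_series_def[of "fps_nth (F * G)"] by (simp add: sums_iff)
qed

lemma mat_series_uminus:
  "mat_series (fps_nth F) (- A) = mat_series (fps_nth (fps_compose F (- fps_X))) A"
  by (simp only: mat_series_def mat_power_uminus fps_compose_uminus' fps_nth_Abs_fps scaleR_scaleR
        mult.commute)

lemma mat_series_commute:
  fixes A :: "real^'n^'n"
  assumes "ereal (norm A) < fps_conv_radius F" and "A ** B = B ** A"
  shows "mat_series (fps_nth F) A ** B = B ** mat_series (fps_nth F) A"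
proof -
  note s = mat_series_sums[OF assms(1)]
  have "(\<lambda>k. (fps_nth F k *\<^sub>R mat_power A k) ** B) sums (mat_series (fps_nth F) A ** B)"
    by (rule bounded_linear.sums[OF matrix_mult.bounded_linear_left s])
  moreover have "(\<lambda>k. B ** (fps_nth F k *\<^sub>R mat_power A k)) sums (B ** mat_series (fps_nth F) A)"
    by (rule bounded_linear.sums[OF matrix_mult.bounded_linear_right s])
  moreover have "(fps_nth F k *\<^sub>R mat_power A k) ** B = B ** (fps_nth F k *\<^sub>R mat_power A k)" for k
    by (simp only: matrix_mult.scaleR_left matrix_mult.scaleR_right mat_power_commute[OF assms(2)])
  ultimately show ?thesis
    by (auto intro: sums_unique2)
qed

text \<open>
  Only the constant term survives.  Applied to row sums, this says that the exponential of a matrix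
  with vanishing row sums has row sums \<open>1\<close>.
\<close>

lemma mat_series_annihilate:
  fixes A :: "real^'n^'n"
  assumes "ereal (norm A) < fps_conv_radius F" and "A ** B = 0"
  shows "mat_series (fps_nth F) A ** B = fps_nth F 0 *\<^sub>R B"
proof -
  have pow: "mat_power A (Suc k) ** B = 0" for k
    using assms(2) by (induction k) (simp_all flip: matrix_mul_assoc)
  have "(\<lambda>k. (fps_nth F k *\<^sub>R mat_power A k) ** B) sums (mat_series (fps_nth F) A ** B)"
    by (intro bounded_linear.sums[OF matrix_mult.bounded_linear_left] mat_series_sums assms)
  moreover have "(\<lambda>k. (fps_nth F k *\<^sub>R mat_power A k) ** B) sums (fps_nth F 0 *\<^sub>R B)"
  proof -
    have "(fps_nth F k *\<^sub>R mat_power A k) ** B = (if k = 0 then fps_nth F 0 *\<^sub>R B else 0)" for k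
      using pow by (cases k) (simp_all add: matrix_mult.scaleR_left)
    then show ?thesis
      using sums_single[of 0 "\<lambda>_. fps_nth F 0 *\<^sub>R B"] by simp
  qed
  ultimately show ?thesis by (rule sums_unique2)
qed

lemma mat_power_has_vector_derivative:
  assumes "(X has_vector_derivative X') (at t within S)" and "X t ** X' = X' ** X t"
  shows "((\<lambda>t. mat_power (X t) k) has_vector_derivative
            of_nat k *\<^sub>R (mat_power (X t) (k - 1) ** X')) (at t within S)"
proof (induction k)
  case (Suc k)
  have "((\<lambda>t. X t ** mat_power (X t) k) has_vector_derivative
      (X t ** (of_nat k *\<^sub>R (mat_power (X t) (k - 1) ** X')) + X' ** mat_power (X t) k)) (at t within S)"
    by (rule matrix_mult.has_vector_derivative[OF assms(1) Suc])
  moreover have "X t ** (of_nat k *\<^sub>R (mat_power (X t) (k - 1) ** X')) + X' ** mat_power (X t) k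
      = of_nat (Suc k) *\<^sub>R (mat_power (X t) k ** X')"
  proof (cases k)
    case (Suc j)
    have "X t ** (mat_power (X t) (k - 1) ** X') = mat_power (X t) k ** X'"
      by (simp add: Suc matrix_mul_assoc)
    then show ?thesis
      using mat_power_commute[OF assms(2), of k]
      by (simp add: matrix_mult.scaleR_right scaleR_left_distrib)
  qed simp
  ultimately show ?case by simp
qed simp

text \<open>
  Termwise differentiation.  The bounds \<open>K\<close> and \<open>L\<close> dominate the differentiated series on \<open>S\<close> by a
  convergent series of numbers, which makes its convergence uniform.
\<close>

lemma mat_series_has_vector_derivative:
  fixes X :: "real \<Rightarrow> real^'n^'n"
  assumes "convex S"
    and deriv: "\<And>t. t \<in> S \<Longrightarrow> (X has_vector_derivative X' t) (at t within S)"
    and comm: "\<And>t. t \<in> S \<Longrightarrow> X t ** X' t = X' t ** X t"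
    and K: "\<And>t. t \<in> S \<Longrightarrow> norm (X t) \<le> K" "ereal K < fps_conv_radius F"
    and L: "\<And>t. t \<in> S \<Longrightarrow> norm (X' t) \<le> L"
    and t: "t \<in> S"
  shows "((\<lambda>t. mat_series (fps_nth F) (X t)) has_vector_derivative
            mat_series (fps_nth (fps_deriv F)) (X t) ** X' t) (at t within S)"
proof -
  have K0: "0 \<le> K" and L0: "0 \<le> L"
    using K(1)[OF t] L[OF t] norm_ge_zero order_trans by blast+
  have rad: "ereal (norm (X s)) < fps_conv_radius F" if "s \<in> S" for s
    using K(1)[OF that] K(2) by (meson ereal_less_eq(3) le_less_trans)
  have K': "ereal K < fps_conv_radius (fps_deriv F)"
    using K(2) fps_conv_radius_deriv[of F] by (rule less_le_trans)
  have rad': "ereal (norm (X s)) < fps_conv_radius (fps_deriv F)" if "s \<in> S" for s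
    using K(1)[OF that] K' by (meson ereal_less_eq(3) le_less_trans)
  define v where "v k s = fps_nth F k *\<^sub>R (of_nat k *\<^sub>R (mat_power (X s) (k - 1) ** X' s))" for k s
  define w where "w s = mat_series (fps_nth (fps_deriv F)) (X s) ** X' s" for s
  have v_Suc: "v (Suc k) s = (fps_nth (fps_deriv F) k *\<^sub>R mat_power (X s) k) ** X' s" for k s
    by (simp add: v_def matrix_mult.scaleR_left mult_ac)
  have v_sums: "(\<lambda>k. v k s) sums w s" if "s \<in> S" for s
  proof -
    have "(\<lambda>k. v (Suc k) s) sums w s"
      unfolding v_Suc w_def
      by (intro bounded_linear.sums[OF matrix_mult.bounded_linear_left] mat_series_sums rad' that)
    then show ?thesis by (subst (asm) sums_Suc_iff) (simp add: v_def)
  qed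
  have "uniform_limit S (\<lambda>n s. \<Sum>k<n. v k s) (\<lambda>s. suminf (\<lambda>k. v k s)) sequentially"
  proof (rule Weierstrass_m_test)
    define m where
      "m k = \<bar>fps_nth F k\<bar> * of_nat k * (norm (mat 1 :: real^'n^'n) * K ^ (k - 1)) * L" for k
    show "norm (v k s) \<le> m k" if "s \<in> S" for k s
    proof -
      have "norm (mat_power (X s) (k - 1) ** X' s) \<le> norm (mat_power (X s) (k - 1)) * norm (X' s)"
        by (rule norm_matrix_mult_le)
      also have "\<dots> \<le> (norm (mat 1 :: real^'n^'n) * K ^ (k - 1)) * L"
        using K(1)[OF that] L[OF that] K0
        by (intro mult_mono order_trans[OF norm_mat_power_le] mult_left_mono power_mono) auto
      finally show ?thesis
        unfolding v_def m_def
        using mult_left_mono[of _ _ "\<bar>fps_nth F k\<bar> * of_nat k"] by (simp add: abs_mult mult.assoc)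
    qed
    have "summable (\<lambda>k. norm (fps_nth (fps_deriv F) k * K ^ k))"
      using K' K0 by (intro abs_summable_in_conv_radius) (simp add: fps_conv_radius_def)
    then have "summable (\<lambda>k. norm (mat 1 :: real^'n^'n) * L * norm (fps_nth (fps_deriv F) k * K ^ k))"
      by (rule summable_mult)
    moreover have "norm (mat 1 :: real^'n^'n) * L * norm (fps_nth (fps_deriv F) k * K ^ k) = m (Suc k)" for k
      using K0 unfolding m_def by (simp add: abs_mult power_abs)
    ultimately show "summable m"
      by (simp only: flip: summable_Suc_iff[of m])
  qed
  then have unif: "uniform_limit S (\<lambda>n s. \<Sum>k<n. v k s) w sequentially"
    by (rule iffD1[OF uniform_limit_cong', rotated 2]) (use v_sums in \<open>auto simp: sums_iff\<close>)
  have "\<exists>g. \<forall>s\<in>S. (\<lambda>k. fps_nth F k *\<^sub>R mat_power (X s) k) sums g s \<and>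
          (g has_derivative (\<lambda>h. h *\<^sub>R w s)) (at s within S)"
  proof (rule has_derivative_series[where f' = "\<lambda>k s h. h *\<^sub>R v k s"])
    show "((\<lambda>s. fps_nth F k *\<^sub>R mat_power (X s) k) has_derivative (\<lambda>h. h *\<^sub>R v k s)) (at s within S)"
      if "s \<in> S" for k s
      using bounded_linear.has_vector_derivative[OF bounded_linear_scaleR_right
          mat_power_has_vector_derivative[OF deriv[OF that] comm[OF that]], of "fps_nth F k" k]
      by (simp add: v_def has_vector_derivative_def)
    show "\<forall>\<^sub>F n in sequentially. \<forall>s\<in>S. \<forall>h. norm ((\<Sum>k<n. h *\<^sub>R v k s) - h *\<^sub>R w s) \<le> e * norm h"
      if "e > 0" for e
      using uniform_limitD[OF unif that]
    proof (eventually_elim, intro ballI allI)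
      fix n s and h :: real
      assume "\<forall>s\<in>S. dist (\<Sum>k<n. v k s) (w s) < e" and "s \<in> S"
      then have "norm ((\<Sum>k<n. v k s) - w s) \<le> e" by (simp add: dist_norm less_imp_le)
      then have "\<bar>h\<bar> * norm ((\<Sum>k<n. v k s) - w s) \<le> \<bar>h\<bar> * e" by (simp add: mult_left_mono)
      then show "norm ((\<Sum>k<n. h *\<^sub>R v k s) - h *\<^sub>R w s) \<le> e * norm h"
        by (simp add: mult.commute flip: scaleR_sum_right scaleR_diff_right)
    qed
    show "(\<lambda>k. fps_nth F k *\<^sub>R mat_power (X t) k) sums mat_series (fps_nth F) (X t)"
      by (intro mat_series_sums rad t)
  qed (use \<open>convex S\<close> t in auto)
  then obtain g where g: "\<And>s. s \<in> S \<Longrightarrow> (\<lambda>k. fps_nth F k *\<^sub>R mat_power (X s) k) sums g s"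
      "\<And>s. s \<in> S \<Longrightarrow> (g has_vector_derivative w s) (at s within S)"
    by (auto simp: has_vector_derivative_def)
  have "g s = mat_series (fps_nth F) (X s)" if "s \<in> S" for s
    using g(1)[OF that] mat_series_sums[OF rad[OF that]] by (rule sums_unique2)
  then show ?thesis
    using has_vector_derivative_transform[OF t _ g(2)[OF t]] by (simp add: w_def)
qed

section \<open>The matrix exponential and the Bernoulli function\<close>

lemma mat_exp_eq_mat_series: "mat_exp = mat_series (fps_nth (fps_exp 1))"
proof -
  have "fps_nth (fps_exp 1) = (\<lambda>k. 1 / fact k :: real)" by (rule ext) simp
  then show ?thesis by (simp add: mat_exp_def)
qed

lemma mat_exp_uminus_eq_mat_series: "mat_exp (- A) = mat_series (fps_nth (fps_exp (- 1))) A"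
  by (simp add: mat_exp_eq_mat_series mat_series_uminus)

lemma mat_exp_0: "mat_exp 0 = mat 1"
  using mat_series_annihilate[of 0 "fps_exp 1" "mat 1"] by (simp add: mat_exp_eq_mat_series)

lemma mat_exp_mult_uminus:
  shows "mat_exp A ** mat_exp (- A) = mat 1" and "mat_exp (- A) ** mat_exp A = mat 1"
proof -
  have "mat_series (fps_nth 1) A = mat 1"
  proof -
    have "(fps_nth 1 k *\<^sub>R mat_power A k) = (if k = 0 then mat 1 else 0)" for k
      by simp
    then show ?thesis
      unfolding mat_series_def using sums_single[of 0 "\<lambda>_. mat 1 :: real^'a^'a"]
      by (simp add: sums_iff)
  qed
  then show "mat_exp A ** mat_exp (- A) = mat 1" "mat_exp (- A) ** mat_exp A = mat 1"
    unfolding mat_exp_uminus_eq_mat_series unfolding mat_exp_eq_mat_series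
    by (simp_all add: mat_series_mult flip: fps_exp_add_mult)
qed

text \<open>
  Over the reals, induction works because the derivative of a function with an expansion has the
  formally differentiated expansion.
\<close>

lemma has_fps_expansion_imp_taylor_coeff:
  fixes f :: "real \<Rightarrow> real"
  assumes "f has_fps_expansion F"
  shows "(deriv ^^ k) f 0 / fact k = fps_nth F k"
  using assms
proof (induction k arbitrary: f F)
  case 0
  then show ?case
    by (auto simp: has_fps_expansion_def eval_fps_at_0 dest: eventually_nhds_x_imp_x)
next
  case (Suc k)
  have "(deriv ^^ Suc k) f 0 / fact (Suc k) = (deriv ^^ k) (deriv f) 0 / fact k / of_nat (Suc k)"
    by (simp only: funpow_Suc_right o_apply fact_Suc) (simp add: field_simps)
  also have "\<dots> = fps_nth (fps_deriv F) k / of_nat (Suc k)"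
    by (subst Suc.IH[OF has_fps_expansion_deriv[OF Suc.prems]]) simp
  also have "\<dots> = fps_nth F (Suc k)" by (simp add: field_simps)
  finally show ?case .
qed

text \<open>The series of the entire function \<open>\<phi>(z) = (e\<^sup>z - 1) / z\<close>, the reciprocal of \<open>bern_fun\<close>.\<close>

definition exp_quotient_fps :: "real fps" where
  "exp_quotient_fps = fps_shift 1 (fps_exp 1 - 1)"

lemma fps_X_mult_exp_quotient: "fps_X * exp_quotient_fps = fps_exp 1 - 1"
  unfolding exp_quotient_fps_def
  by (rule fps_ext) (simp add: fps_X_mult_nth)

lemma exp_quotient_fps_nth: "fps_nth exp_quotient_fps k = 1 / fact (Suc k)"
  by (simp add: exp_quotient_fps_def algebra_simps)

lemma bern_fun_has_fps_expansion: "bern_fun has_fps_expansion inverse exp_quotient_fps"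
proof -
  have "(\<lambda>x::real. if x = 0 then 1 else (exp x - 1) / x ^ 1) has_fps_expansion exp_quotient_fps"
    unfolding exp_quotient_fps_def
    by (intro has_fps_expansion_shift has_fps_expansion_diff has_fps_expansion_exp1
          has_fps_expansion_1 subdegree_geI) (auto simp: fps_eq_iff intro!: exI[of _ 1])
  then have "(\<lambda>x::real. inverse (if x = 0 then 1 else (exp x - 1) / x ^ 1))
      has_fps_expansion inverse exp_quotient_fps"
    by (rule has_fps_expansion_inverse) (simp add: exp_quotient_fps_nth)
  also have "(\<lambda>x::real. inverse (if x = 0 then 1 else (exp x - 1) / x ^ 1)) = bern_fun"
    by (simp add: bern_fun_def fun_eq_iff)
  finally show ?thesis .
qed

lemma mat_bern_fun_eq_mat_series: "mat_bern_fun = mat_series (fps_nth (inverse exp_quotient_fps))"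
  unfolding mat_bern_fun_def has_fps_expansion_imp_taylor_coeff[OF bern_fun_has_fps_expansion] ..

text \<open>
  Replacing \<open>z\<close> by \<open>-z\<close> in \<open>z \<phi>(z) = e\<^sup>z - 1\<close> and multiplying by \<open>e\<^sup>z\<close> shows
  \<open>\<phi>(z) = e\<^sup>z \<phi>(-z)\<close>.  Multiplying by the series of \<open>1 / \<phi>(-z)\<close> gives the claim.
\<close>

lemma bern_fps_reflect_mult_exp_quotient:
  "fps_compose (inverse exp_quotient_fps) (- fps_X) * exp_quotient_fps = fps_exp 1"
proof -
  let ?P = "exp_quotient_fps" and ?P' = "fps_compose exp_quotient_fps (- fps_X)"
  have "- fps_X * ?P' = fps_compose (fps_X * ?P) (- fps_X)"
    by (simp add: fps_compose_mult_distrib)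
  also have "\<dots> = fps_exp (- 1) - 1"
    by (simp add: fps_X_mult_exp_quotient fps_compose_sub_distrib)
  finally have reflected: "- fps_X * ?P' = fps_exp (- 1) - 1" .
  have "fps_X * (fps_exp 1 * ?P') = fps_exp 1 * - (- fps_X * ?P')"
    by simp
  also have "\<dots> = fps_exp 1 * (1 - fps_exp (- 1))"
    unfolding reflected by simp
  also have "\<dots> = fps_exp 1 - 1"
    by (simp add: right_diff_distrib flip: fps_exp_add_mult)
  also have "\<dots> = fps_X * ?P"
    by (simp add: fps_X_mult_exp_quotient)
  finally have *: "?P = fps_exp 1 * ?P'" by simp
  have "fps_compose (inverse ?P) (- fps_X) * ?P' = 1"
    by (simp add: exp_quotient_fps_nth inverse_mult_eq_1 flip: fps_compose_mult_distrib)
  then show ?thesis by (subst *) (simp add: mult.left_commute)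
qed

lemma fps_conv_radius_exp_quotient: "fps_conv_radius exp_quotient_fps = \<infinity>"
  using fps_conv_radius_diff[of "fps_exp 1 :: real fps" 1] by (simp add: exp_quotient_fps_def)

lemma fps_conv_radius_compose_uminus:
  fixes F :: "real fps"
  shows "fps_conv_radius (fps_compose F (- fps_X)) = fps_conv_radius F"
  by (simp add: fps_conv_radius_def conv_radius_def fps_compose_uminus' abs_mult)

text \<open>
  In the expansion of a power of \<open>A + D\<close>, a factor \<open>D\<close> anywhere but in first place follows \<open>A\<close> or \<open>D\<close>
  and is killed.  So \<open>(A + D)\<^sup>k\<^sup>+\<^sup>1 = A\<^sup>k\<^sup>+\<^sup>1 + D A\<^sup>k\<close>, and summing with the weights \<open>1 / (k + 1)!\<close>
  produces \<open>\<phi>\<close>.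
\<close>

lemma mat_exp_add_left_annihilated:
  fixes A D :: "real^'n^'n"
  assumes "A ** D = 0" and "D ** D = 0"
  shows "mat_exp (A + D) = mat_exp A + D ** mat_series (fps_nth exp_quotient_fps) A"
proof -
  have pow: "mat_power (A + D) (Suc k) = mat_power A (Suc k) + D ** mat_power A k" for k
  proof (induction k)
    case (Suc k)
    have "mat_power (A + D) (Suc (Suc k)) = (A + D) ** (mat_power A (Suc k) + D ** mat_power A k)"
      using Suc by simp
    also have "\<dots> = mat_power A (Suc (Suc k)) + D ** mat_power A (Suc k)"
      using assms by (simp add: matrix_add_ldistrib matrix_mult.add_left matrix_mul_assoc)
    finally show ?case .
  qed simp
  let ?e = "\<lambda>B k. fps_nth (fps_exp 1) k *\<^sub>R mat_power B k :: real^'n^'n"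
  have e: "?e B sums mat_exp B" for B
    unfolding mat_exp_eq_mat_series by (intro mat_series_sums) simp
  have tail: "(\<lambda>k. ?e B (Suc k)) sums (mat_exp B - mat 1)" for B
    by (rule iffD2[OF sums_Suc_iff[of "?e B"]]) (use e[of B] in simp)
  have "(\<lambda>k. D ** (fps_nth exp_quotient_fps k *\<^sub>R mat_power A k)) sums
          (D ** mat_series (fps_nth exp_quotient_fps) A)"
    by (intro bounded_linear.sums[OF matrix_mult.bounded_linear_right] mat_series_sums)
       (simp add: fps_conv_radius_exp_quotient)
  from sums_add[OF tail[of A] this]
  have "(\<lambda>k. ?e (A + D) (Suc k)) sums
          (mat_exp A - mat 1 + D ** mat_series (fps_nth exp_quotient_fps) A)"
    by (simp only: pow) (simp add: exp_quotient_fps_nth matrix_mult.scaleR_right scaleR_add_right del: fact_Suc)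
  from sums_unique2[OF tail this] show ?thesis by (simp add: algebra_simps)
qed

text \<open>
  The correction term is designed so that the factor \<open>\<phi>(A)\<close> of \<open>mat_exp_add_left_annihilated\<close> turns into
  \<open>e\<^sup>A\<close>.
\<close>

lemma mat_exp_add_bern:
  fixes A P :: "real^'n^'n"
  assumes "A ** P = 0" and "P ** P = 0"
    and conv: "ereal (norm A) < fps_conv_radius (inverse exp_quotient_fps)"
  shows "mat_exp (A + P ** mat_bern_fun (- A)) = (mat 1 + P) ** mat_exp A"
proof -
  let ?B = "mat_bern_fun (- A)"
  have B: "?B = mat_series (fps_nth (fps_compose (inverse exp_quotient_fps) (- fps_X))) A"
    by (simp add: mat_bern_fun_eq_mat_series mat_series_uminus)
  have "?B ** P = P"
    unfolding mat_bern_fun_eq_mat_series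
    by (subst mat_series_annihilate) (use assms in
      \<open>simp_all add: matrix_mult.minus_left exp_quotient_fps_nth\<close>)
  then have "(P ** ?B) ** (P ** ?B) = 0"
    using assms(2) by (metis matrix_mul_assoc matrix_mult.zero_left)
  moreover have "A ** (P ** ?B) = 0"
    by (simp add: assms matrix_mul_assoc)
  ultimately have "mat_exp (A + P ** ?B) =
      mat_exp A + (P ** ?B) ** mat_series (fps_nth exp_quotient_fps) A"
    by (intro mat_exp_add_left_annihilated)
  also have "?B ** mat_series (fps_nth exp_quotient_fps) A = mat_exp A"
    unfolding B
    by (subst mat_series_mult)
       (use conv in \<open>simp_all add: bern_fps_reflect_mult_exp_quotient mat_exp_eq_mat_series
          fps_conv_radius_exp_quotient fps_conv_radius_compose_uminus\<close>)
  then have "(P ** ?B) ** mat_series (fps_nth exp_quotient_fps) A = P ** mat_exp A"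
    by (simp flip: matrix_mul_assoc)
  finally show ?thesis by (simp add: matrix_mult.add_left)
qed

section \<open>Row sums\<close>

text \<open>
  Multiplying by the all-ones matrix \<open>const_rows 1\<close> from the right records the row sums.  It turns
  conditions on row sums into matrix equations, which commute with integrals and power series.
\<close>

lemma row_sum_zero_iff: "A \<in> row_sum_zero \<longleftrightarrow> A ** const_rows (1 :: real^'n) = 0"
  by (simp add: row_sum_zero_def const_rows_def matrix_matrix_mult_def vec_eq_iff)

lemma row_sum_zero_mult_const_rows: "A \<in> row_sum_zero \<Longrightarrow> A ** const_rows x = 0"
  by (simp add: row_sum_zero_def const_rows_def matrix_matrix_mult_def vec_eq_iff
        flip: sum_distrib_right)

lemma const_rows_fixed:
  fixes A :: "real^'n^'n"
  assumes "A ** const_rows (1 :: real^'n) = const_rows 1"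
  shows "A ** const_rows x = const_rows x"
  using assms by (simp add: const_rows_def matrix_matrix_mult_def vec_eq_iff
        flip: sum_distrib_right)

lemma const_rows_row_sum_zero: "trace (const_rows x) = 0 \<Longrightarrow> const_rows x \<in> row_sum_zero"
  by (simp add: trace_def const_rows_def row_sum_zero_def)

text \<open>
  The supremum that defines the spectral radius is bounded by the norm only if the spectrum is
  nonempty.  Here the all-ones vector is an eigenvector for the eigenvalue \<open>0\<close>.
\<close>

lemma spectral_radius_le_norm_if_row_sum_zero:
  assumes "A \<in> row_sum_zero"
  shows "spectral_radius A \<le> norm A"
proof (rule spectral_radius_le_norm)
  have "map_matrix complex_of_real A *v 1 = 0 *s 1"
    using assms by (simp add: row_sum_zero_def matrix_vector_mult_def map_matrix_def vec_eq_iff flip: of_real_sum)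
  then have "0 \<in> complex_eigenvalues A"
    unfolding complex_eigenvalues_def by (intro CollectI exI[of _ 1]) simp
  then show "complex_eigenvalues A \<noteq> {}" by blast
qed

section \<open>The Cauchy problem\<close>

theorem corollary4p6:
  fixes Q0 :: "real \<Rightarrow> real ^ 'n ^ 'n"
    and q :: "real \<Rightarrow> real ^ 'n"
    and Q R0 Rtri R :: "real \<Rightarrow> real ^ 'n ^ 'n"
  assumes Q0_row_sums: "\<And>t. 0 \<le> t \<Longrightarrow> Q0 t \<in> row_sum_zero"
    and Q0_cont: "continuous_on {0..} Q0"
    and q_cont: "continuous_on {0..} q"
    and Q0_commute: "\<And>t s. 0 \<le> t \<Longrightarrow> 0 \<le> s \<Longrightarrow> mat_comm (Q0 t) (Q0 s) = 0"
    and trace_zero: "\<And>t. 0 \<le> t \<Longrightarrow> trace (const_rows (q t)) = 0"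
  defines "Q \<equiv> \<lambda>t. Q0 t + const_rows (q t)"
    and "R0 \<equiv> \<lambda>t. integral {0..t} Q0"
    and "Rtri \<equiv> \<lambda>t. integral {0..t} (\<lambda>s. const_rows (q s) ** mat_exp (- R0 s))
                     ** mat_bern_fun (- R0 t)"
    and "R \<equiv> \<lambda>t. R0 t + Rtri t"
  shows "\<exists>\<epsilon>>0. (\<forall>t\<in>{0..<\<epsilon>}. spectral_radius (- R0 t) < 2 * pi) \<and>
           solves_cauchy Q (\<lambda>t. mat_exp (R t)) {0..<\<epsilon>} \<and>
           (\<forall>M. solves_cauchy Q M {0..<\<epsilon>} \<longrightarrow> (\<forall>t\<in>{0..<\<epsilon>}. M t = mat_exp (R t)))"
proof -
  define C where "C t = const_rows (q t)" for t
  define J :: "real^'n^'n" where "J = const_rows 1"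
  define E where "E t = mat_exp (R0 t)" for t
  define G where "G t = mat_exp (- R0 t)" for t
  define P where "P t = integral {0..t} (\<lambda>s. C s ** G s)" for t

  have Q0_int: "Q0 integrable_on {0..t}" for t
    by (intro integrable_continuous_interval continuous_on_subset[OF Q0_cont]) auto
  have C_row_sums: "C t \<in> row_sum_zero" if "0 \<le> t" for t
    unfolding C_def by (intro const_rows_row_sum_zero trace_zero that)
  have comm: "Q0 t ** Q0 s = Q0 s ** Q0 t" if "0 \<le> t" "0 \<le> s" for t s
    using Q0_commute[OF that] by (simp add: mat_comm_def)
  have R0_comm: "R0 t ** Q0 s = Q0 s ** R0 t" if "0 \<le> s" for t s
  proof -
    have "R0 t ** Q0 s = integral {0..t} (\<lambda>u. Q0 u ** Q0 s)"
      using integral_linear[OF Q0_int matrix_mult.bounded_linear_left, of t "Q0 s"]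
      by (simp add: R0_def o_def)
    also have "\<dots> = integral {0..t} (\<lambda>u. Q0 s ** Q0 u)"
      by (intro integral_cong comm that) simp
    also have "\<dots> = Q0 s ** R0 t"
      using integral_linear[OF Q0_int matrix_mult.bounded_linear_right, of t "Q0 s"]
      by (simp add: R0_def o_def)
    finally show ?thesis .
  qed
  have R0_J: "R0 t ** J = 0" for t
  proof -
    have "R0 t ** J = integral {0..t} (\<lambda>u. Q0 u ** J)"
      using integral_linear[OF Q0_int matrix_mult.bounded_linear_left, of t J]
      by (simp add: R0_def o_def)
    also have "\<dots> = integral {0..t} (\<lambda>u. 0)"
      using Q0_row_sums by (intro integral_cong) (simp add: J_def row_sum_zero_iff)
    finally show ?thesis by simp
  qed
  have R0_row_sums: "R0 t \<in> row_sum_zero" for t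
    using R0_J[of t] by (simp add: row_sum_zero_iff J_def)

  \<comment> \<open>The calculus is done on the compact interval \<open>{0..1}\<close>, where all functions are bounded;
    \<open>\<epsilon> \<le> 1\<close> below restricts it to \<open>{0..<\<epsilon>}\<close>.\<close>
  have R0_deriv: "(R0 has_vector_derivative Q0 t) (at t within {0..1})" if "t \<in> {0..1}" for t
    unfolding R0_def
    by (intro integral_has_vector_derivative continuous_on_subset[OF Q0_cont] that) auto
  have R0_cont: "continuous_on {0..1} R0"
    unfolding continuous_on_eq_continuous_within
    using has_vector_derivative_continuous[OF R0_deriv] by blast
  have bounded: "\<exists>B. \<forall>t\<in>{0..1}. norm (F t) \<le> B" if "continuous_on {0..1} F"
    for F :: "real \<Rightarrow> real^'n^'n"
    using compact_imp_bounded[OF compact_continuous_image[OF that compact_Icc]]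
    by (auto simp: bounded_iff)
  obtain K where K: "\<And>t. t \<in> {0..1} \<Longrightarrow> norm (R0 t) \<le> K"
    using bounded[OF R0_cont] by blast
  have "continuous_on {0..1} Q0"
    by (rule continuous_on_subset[OF Q0_cont]) auto
  from bounded[OF this] obtain L where L: "\<And>t. t \<in> {0..1} \<Longrightarrow> norm (Q0 t) \<le> L"
    by blast
  \<comment> \<open>The parameter \<open>c\<close> covers both \<open>exp R\<^sub>0\<close> (\<open>c = 1\<close>) and \<open>exp (-R\<^sub>0)\<close> (\<open>c = -1\<close>).\<close>
  have exp_deriv: "((\<lambda>t. mat_series (fps_nth (fps_exp c)) (R0 t)) has_vector_derivative
      c *\<^sub>R (mat_series (fps_nth (fps_exp c)) (R0 t) ** Q0 t)) (at t within {0..1})"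
    if "t \<in> {0..1}" for c t
  proof -
    have "mat_series (fps_nth (fps_deriv (fps_exp c))) (R0 t) = c *\<^sub>R mat_series (fps_nth (fps_exp c)) (R0 t)"
      using bounded_linear.sums[OF bounded_linear_scaleR_right mat_series_sums[of "R0 t" "fps_exp c"], of c]
      unfolding mat_series_def[of "fps_nth (fps_deriv (fps_exp c))"] by (simp add: sums_iff)
    then show ?thesis
      using mat_series_has_vector_derivative[of "{0..1}" R0 Q0 K "fps_exp c" L t]
        R0_deriv R0_comm K L that by (simp add: matrix_mult.scaleR_left)
  qed
  have E_deriv: "(E has_vector_derivative E t ** Q0 t) (at t within {0..1})" if "t \<in> {0..1}" for t
    using exp_deriv[OF that, of 1] by (simp add: E_def[abs_def] mat_exp_eq_mat_series)
  have G_deriv: "(G has_vector_derivative - (G t ** Q0 t)) (at t within {0..1})" if "t \<in> {0..1}" for t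
    using exp_deriv[OF that, of "- 1"] by (simp add: G_def[abs_def] mat_exp_uminus_eq_mat_series)
  have EG: "E t ** G t = mat 1" "G t ** E t = mat 1" for t
    by (simp_all add: E_def G_def mat_exp_mult_uminus)
  have E_C: "E t ** C s = C s" for t s
    unfolding E_def mat_exp_eq_mat_series C_def
    by (subst mat_series_annihilate) (simp_all add: row_sum_zero_mult_const_rows R0_row_sums)
  have G_J: "G t ** J = J" for t
    unfolding G_def mat_exp_uminus_eq_mat_series
    by (subst mat_series_annihilate) (simp_all add: R0_J)
  have G_Q0: "G t ** Q0 t = Q0 t ** G t" if "0 \<le> t" for t
    unfolding G_def mat_exp_uminus_eq_mat_series
    by (intro mat_series_commute R0_comm that) simp

  have C_cont: "continuous_on {0..1} C"
    unfolding C_def const_rows_def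
    by (intro continuous_on_vec_lambda continuous_on_subset[OF q_cont]) auto
  have "continuous_on {0..1} G"
    unfolding continuous_on_eq_continuous_within
    using has_vector_derivative_continuous[OF G_deriv] by blast
  then have CG_cont: "continuous_on {0..1} (\<lambda>s. C s ** G s)"
    by (intro matrix_mult.continuous_on C_cont)
  have CG_int: "(\<lambda>s. C s ** G s) integrable_on {0..t}" if "t \<in> {0..1}" for t
    by (intro integrable_continuous_interval continuous_on_subset[OF CG_cont]) (use that in auto)
  have P_deriv: "(P has_vector_derivative C t ** G t) (at t within {0..1})" if "t \<in> {0..1}" for t
    unfolding P_def by (intro integral_has_vector_derivative CG_cont that)
  have P_J: "P t ** J = 0" if "t \<in> {0..1}" for t
  proof -
    have "P t ** J = integral {0..t} (\<lambda>s. (C s ** G s) ** J)"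
      using integral_linear[OF CG_int[OF that] matrix_mult.bounded_linear_left, of J]
      by (simp add: P_def o_def)
    also have "\<dots> = integral {0..t} (\<lambda>s. 0)"
    proof (intro integral_cong)
      fix s assume "s \<in> {0..t}"
      then have "C s ** J = 0" using C_row_sums[of s] by (simp add: row_sum_zero_iff J_def)
      then show "(C s ** G s) ** J = 0" by (simp add: G_J flip: matrix_mul_assoc)
    qed
    finally show ?thesis by simp
  qed
  have P_row_sums: "P t \<in> row_sum_zero" if "t \<in> {0..1}" for t
    using P_J[OF that] by (simp add: row_sum_zero_iff J_def)
  have annihilates_P: "A ** P t = 0" if "A \<in> row_sum_zero" "t \<in> {0..1}" for A t
  proof -
    have "A ** P t = integral {0..t} (\<lambda>s. A ** (C s ** G s))"
      using integral_linear[OF CG_int[OF that(2)] matrix_mult.bounded_linear_right, of A]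
      by (simp add: P_def o_def)
    also have "(\<lambda>s. A ** (C s ** G s)) = (\<lambda>s. 0)"
      by (simp add: fun_eq_iff matrix_mul_assoc C_def row_sum_zero_mult_const_rows that)
    finally show ?thesis by simp
  qed

  have "0 < fps_conv_radius (inverse exp_quotient_fps)"
    using bern_fun_has_fps_expansion by (simp add: has_fps_expansion_def)
  then obtain \<rho> where \<rho>: "0 < \<rho>" "ereal \<rho> < fps_conv_radius (inverse exp_quotient_fps)"
    using ereal_dense2[of 0] by auto
  have "R0 0 = 0" by (simp add: R0_def)
  moreover have "0 < min \<rho> (2 * pi)" using \<rho>(1) by simp
  ultimately obtain \<delta> where \<delta>: "0 < \<delta>"
      "\<And>t. t \<in> {0..1} \<Longrightarrow> t < \<delta> \<Longrightarrow> norm (R0 t) < min \<rho> (2 * pi)"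
    using R0_cont[unfolded continuous_on_iff, rule_format, of 0 "min \<rho> (2 * pi)"]
    by (auto simp: dist_norm)
  define \<epsilon> where "\<epsilon> = min \<delta> 1"
  have \<epsilon>: "0 < \<epsilon>" using \<delta>(1) by (simp add: \<epsilon>_def)
  have sub: "{0..<\<epsilon>} \<subseteq> {0..1}" by (auto simp: \<epsilon>_def)
  have small: "norm (R0 t) < \<rho>" "norm (R0 t) < 2 * pi" if "t \<in> {0..<\<epsilon>}" for t
    using \<delta>(2)[of t] that by (auto simp: \<epsilon>_def)

  have exp_R: "mat_exp (R t) = (mat 1 + P t) ** E t" if t: "t \<in> {0..<\<epsilon>}" for t
  proof -
    have t1: "t \<in> {0..1}" using t sub by blast
    have "R t = R0 t + P t ** mat_bern_fun (- R0 t)"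
      by (simp add: R_def Rtri_def P_def C_def G_def)
    moreover have "ereal (norm (R0 t)) < fps_conv_radius (inverse exp_quotient_fps)"
      using small(1)[OF t] \<rho>(2) by (meson ereal_less(2) less_ereal.simps(1) less_trans)
    ultimately show ?thesis
      using mat_exp_add_bern[OF annihilates_P[OF R0_row_sums t1] annihilates_P[OF P_row_sums[OF t1] t1]]
      by (simp add: E_def)
  qed

  have "spectral_radius (- R0 t) < 2 * pi" if "t \<in> {0..<\<epsilon>}" for t
  proof -
    have "- R0 t \<in> row_sum_zero"
      using R0_row_sums[of t] by (simp add: row_sum_zero_def sum_negf)
    from spectral_radius_le_norm_if_row_sum_zero[OF this] show ?thesis
      using small(2)[OF that] by simp
  qed
  moreover have "solves_cauchy Q (\<lambda>t. mat_exp (R t)) {0..<\<epsilon>}"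
    unfolding solves_cauchy_def
  proof (intro conjI ballI)
    show "mat_exp (R 0) = mat 1"
      using exp_R[of 0] \<epsilon> by (simp add: P_def E_def R0_def mat_exp_0)
  next
    fix t assume t: "t \<in> {0..<\<epsilon>}"
    then have t1: "t \<in> {0..1}" using sub by blast
    have "((\<lambda>t. (mat 1 + P t) ** E t) has_vector_derivative
        (mat 1 + P t) ** (E t ** Q0 t) + (0 + C t ** G t) ** E t) (at t within {0..1})"
      by (intro matrix_mult.has_vector_derivative has_vector_derivative_add
          has_vector_derivative_const P_deriv E_deriv t1)
    moreover have "(mat 1 + P t) ** (E t ** Q0 t) + (0 + C t ** G t) ** E t = mat_exp (R t) ** Q t"
    proof -
      have "(0 + C t ** G t) ** E t = C t" by (simp add: EG flip: matrix_mul_assoc)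
      also have "C t = (mat 1 + P t) ** E t ** C t"
        using row_sum_zero_mult_const_rows[OF P_row_sums[OF t1]]
        by (simp add: E_C matrix_mult.add_left flip: matrix_mul_assoc) (simp add: C_def)
      finally show ?thesis
        by (simp add: exp_R[OF t] Q_def matrix_add_ldistrib matrix_mul_assoc flip: C_def)
    qed
    ultimately have "((\<lambda>t. (mat 1 + P t) ** E t) has_vector_derivative mat_exp (R t) ** Q t)
        (at t within {0..<\<epsilon>})"
      using has_vector_derivative_within_subset[OF _ sub] by metis
    then show "((\<lambda>t. mat_exp (R t)) has_vector_derivative mat_exp (R t) ** Q t) (at t within {0..<\<epsilon>})"
      by (rule has_vector_derivative_transform[OF t exp_R, rotated])
  qed
  moreover have "M t = mat_exp (R t)" if M: "solves_cauchy Q M {0..<\<epsilon>}" and t: "t \<in> {0..<\<epsilon>}" for M t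
  proof -
    have M0: "M 0 = mat 1"
      and M_deriv: "\<And>s. s \<in> {0..<\<epsilon>} \<Longrightarrow> (M has_vector_derivative M s ** Q s) (at s within {0..<\<epsilon>})"
      using M by (auto simp: solves_cauchy_def)
    have const_on: "F s = F 0"
      if deriv: "\<And>s. s \<in> {0..<\<epsilon>} \<Longrightarrow> (F has_vector_derivative 0) (at s within {0..<\<epsilon>})"
        and s: "s \<in> {0..<\<epsilon>}" for F :: "real \<Rightarrow> real^'n^'n" and s
    proof -
      obtain c where "\<And>x. x \<in> {0..<\<epsilon>} \<Longrightarrow> F x = c"
        using has_vector_derivative_zero_constant[of "{0..<\<epsilon>}" F, OF convex_real_interval(7) deriv] by blast
      then show ?thesis using s \<epsilon> by simp
    qed
    \<comment> \<open>The row sums of a solution stay at their initial value \<open>1\<close>.\<close>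
    have M_J: "M s ** J = J" if "s \<in> {0..<\<epsilon>}" for s
    proof -
      have "((\<lambda>s. M s ** J) has_vector_derivative 0) (at s within {0..<\<epsilon>})" if s: "s \<in> {0..<\<epsilon>}" for s
      proof -
        have "Q s ** J = 0"
          using Q0_row_sums[of s] C_row_sums[of s] s
          by (simp add: Q_def J_def C_def row_sum_zero_iff matrix_mult.add_left)
        then show ?thesis
          using bounded_linear.has_vector_derivative[OF matrix_mult.bounded_linear_left M_deriv[OF s], of J]
          by (simp flip: matrix_mul_assoc)
      qed
      from const_on[OF this that] show ?thesis by (simp add: M0)
    qed
    \<comment> \<open>The terms with \<open>Q\<^sub>0\<close> cancel, and what remains is the derivative of \<open>P\<close>.\<close>
    have "((\<lambda>s. M s ** G s - P s) has_vector_derivative 0) (at s within {0..<\<epsilon>})" if s: "s \<in> {0..<\<epsilon>}" for s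
    proof -
      have s1: "s \<in> {0..1}" using s sub by blast
      have "((\<lambda>s. M s ** G s - P s) has_vector_derivative
          M s ** - (G s ** Q0 s) + (M s ** Q s) ** G s - C s ** G s) (at s within {0..<\<epsilon>})"
        by (intro has_vector_derivative_diff matrix_mult.has_vector_derivative M_deriv s
            has_vector_derivative_within_subset[OF G_deriv[OF s1] sub]
            has_vector_derivative_within_subset[OF P_deriv[OF s1] sub])
      moreover have "(M s ** Q s) ** G s = M s ** (G s ** Q0 s) + C s ** G s"
      proof -
        have "M s ** C s = C s"
          using M_J[OF s] unfolding C_def J_def by (rule const_rows_fixed)
        then have "M s ** Q s = M s ** Q0 s + C s"
          by (simp add: Q_def matrix_add_ldistrib flip: C_def)
        then show ?thesis
          using G_Q0[of s] s by (simp add: matrix_mult.add_left flip: matrix_mul_assoc)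
      qed
      ultimately show ?thesis by (simp add: matrix_mult.minus_right)
    qed
    from const_on[OF this t] have "M t ** G t = mat 1 + P t"
      by (simp add: M0 P_def G_def R0_def mat_exp_0 algebra_simps)
    then have "(M t ** G t) ** E t = mat_exp (R t)" by (simp add: exp_R[OF t])
    then show ?thesis by (simp add: EG flip: matrix_mul_assoc)
  qed
  ultimately show ?thesis using \<epsilon> by blast
qed

end
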